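(* Let $n\ge2$, let $f\in\mathbb{R}[x_1,\ldots,x_n]$ be a form of degree $d>2$, let $g(\mathbf{x})=f(\mathbf{x})\bigl(1-\tfrac{d}{d+2}\|\mathbf{x}\|^2\bigr)$, and let $V_{\rm grad}(g)=W_0\cup\tilde W_1\cup\cdots\cup\tilde W_r$ be the decomposition described in the context. Define $$\Omega:=\{\mathbf{x}\in\mathbb{S}^{n-1}: f(\mathbf{x})<0,\ \lambda_2(\nabla^2 f(\mathbf{x}))\ge-\|\nabla f(\mathbf{x})\|\}.$$ If there is only one index $j^*\ge1$ such that $\tilde W_{j^*}\cap\Omega\neq\emptyset$, then $f$ has no spurious negative local minima on $\mathbb{S}^{n-1}$.
   Context: $\mathbb{S}^{n-1}$ is the Euclidean unit sphere in $\mathbb{R}^n$; a form is a homogeneous polynomial; $\nabla f,\nabla^2 f$ are gradient and Hessian. For a real symmetric matrix $A$, $\lambda_1(A)\le\lambda_2(A)\le\cdots\le\lambda_n(A)$ are its eigenvalues in increasing order. Local minimizer on $\mathbb{S}^{n-1}$: a point $\mathbf{x}^*\in\mathbb{S}^{n-1}$ such that for some $\varepsilon>0$, $f(\mathbf{x}^* )\le f(\mathbf{x})$ for all $\mathbf{x}\in\mathbb{S}^{n-1}$ with $\|\mathbf{x}-\mathbf{x}^*\|<\varepsilon$; $f(\mathbf{x}^* )$ is then a local minimum. A spurious negative local minimum is a local minimum that is $<0$ and is not the global minimum of $f$ on $\mathbb{S}^{n-1}$. Decomposition: $V_{\rm grad}(g):=\{\mathbf{z}\in\mathbb{C}^n:\nabla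 g(\mathbf{z})=0\}$. It is a known fact that this variety can be written as a finite union $W_0\cup W_1\cup\cdots\cup W_s$ of subvarieties, where $W_0\cap\mathbb{R}^n=\emptyset$ ($W_0$ possibly empty), and $W_1,\ldots,W_s$ are irreducible with $g$ equal to a real constant on each of them. Regrouping those $W_j$, $j\ge1$, on which $g$ takes the same value gives $V_{\rm grad}(g)=W_0\cup\tilde W_1\cup\cdots\cup\tilde W_r$, where $g=g_j$ on $\tilde W_j$ for real constants $g_j$ with $g_i\ne g_j$ for $i\neq j$, $1\le i,j\le r$. *)

theory Defs
  imports
    "HOL-Analysis.Analysis"
    "HOL-Library.Poly_Mapping"
    "HOL-Library.Multiset"
    "HOL-Computational_Algebra.Polynomial"
begin

text \<open>
  Polynomials in the variables indexed by a finite type \<open>'n\<close>: finitely supported maps from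
  exponent vectors to coefficients, with the convolution product of \<open>Poly_Mapping\<close>.
\<close>

type_synonym ('n, 'a) mpol = "('n \<Rightarrow>\<^sub>0 nat) \<Rightarrow>\<^sub>0 'a"

definition mp_const :: "'a::zero \<Rightarrow> ('n, 'a) mpol" where
  "mp_const c = Poly_Mapping.single 0 c"

definition mp_var :: "'n \<Rightarrow> ('n, 'a::zero_neq_one) mpol" where
  "mp_var i = Poly_Mapping.single (Poly_Mapping.single i 1) 1"

definition mp_eval :: "('n::finite, 'a::comm_semiring_1) mpol \<Rightarrow> 'a ^ 'n \<Rightarrow> 'a" where
  "mp_eval p z =
    (\<Sum>m\<in>Poly_Mapping.keys p. Poly_Mapping.lookup p m * (\<Prod>i\<in>UNIV. (z $ i) ^ Poly_Mapping.lookup m i))"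

text \<open>
  Formal partial derivative. When \<open>i\<close> does not occur in the monomial \<open>m\<close>, the (truncating)
  subtraction of exponents is harmless because the new coefficient is \<open>0\<close>.
\<close>

definition mp_partial :: "'n \<Rightarrow> ('n, 'a::comm_semiring_1) mpol \<Rightarrow> ('n, 'a) mpol" where
  "mp_partial i p =
    (\<Sum>m\<in>Poly_Mapping.keys p.
      Poly_Mapping.single (m - Poly_Mapping.single i 1)
        (of_nat (Poly_Mapping.lookup m i) * Poly_Mapping.lookup p m))"

definition mp_grad :: "('n::finite, 'a::comm_semiring_1) mpol \<Rightarrow> 'a ^ 'n \<Rightarrow> 'a ^ 'n" where
  "mp_grad p z = (\<chi> i. mp_eval (mp_partial i p) z)"

definition mp_hessian :: "('n::finite, 'a::comm_semiring_1) mpol \<Rightarrow> 'a ^ 'n \<Rightarrow> 'a ^ 'n ^ 'n" where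
  "mp_hessian p z = (\<chi> i j. mp_eval (mp_partial i (mp_partial j p)) z)"

definition is_form :: "nat \<Rightarrow> ('n::finite, 'a::zero) mpol \<Rightarrow> bool" where
  "is_form d p \<longleftrightarrow>
    (\<forall>m\<in>Poly_Mapping.keys p. (\<Sum>i\<in>UNIV. Poly_Mapping.lookup m i) = d)"

definition complexify :: "('n, real) mpol \<Rightarrow> ('n, complex) mpol" where
  "complexify p = Poly_Mapping.map complex_of_real p"

definition complex_vec :: "real ^ 'n \<Rightarrow> complex ^ 'n" where
  "complex_vec x = (\<chi> i. complex_of_real (x $ i))"


text \<open>Eigenvalues: the real roots of the characteristic polynomial, with algebraic multiplicity.\<close>

definition charpoly :: "real ^ 'n ^ 'n \<Rightarrow> real poly" where
  "charpoly A = det (\<chi> i j. (if i = j then [:0, 1:] else 0) - [:A $ i $ j:])"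

text \<open>
  \<open>eigval k A\<close> is the \<open>k\<close>-th smallest eigenvalue, counted from \<open>1\<close>. It is meant for symmetric \<open>A\<close>
  and \<open>1 \<le> k \<le> CARD('n)\<close>, where the list has length \<open>CARD('n)\<close>.
\<close>

definition eigval :: "nat \<Rightarrow> real ^ 'n ^ 'n \<Rightarrow> real" where
  "eigval k A = sorted_list_of_multiset (proots (charpoly A)) ! (k - 1)"


definition zariski_closed :: "(complex ^ 'n::finite) set \<Rightarrow> bool" where
  "zariski_closed V \<longleftrightarrow> (\<exists>P. V = {z. \<forall>p\<in>P. mp_eval p z = 0})"

definition irreducible_variety :: "(complex ^ 'n::finite) set \<Rightarrow> bool" where
  "irreducible_variety V \<longleftrightarrow>
    zariski_closed V \<and> V \<noteq> {} \<and>
    (\<forall>A B. zariski_closed A \<longrightarrow> zariski_closed B \<longrightarrow> V = A \<union> B \<longrightarrow> V = A \<or> V = B)"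

definition V_grad :: "('n::finite, real) mpol \<Rightarrow> (complex ^ 'n) set" where
  "V_grad g = {z. mp_grad (complexify g) z = 0}"

definition const_on :: "('n::finite, real) mpol \<Rightarrow> real \<Rightarrow> (complex ^ 'n) set \<Rightarrow> bool" where
  "const_on g c V \<longleftrightarrow> (\<forall>z\<in>V. mp_eval (complexify g) z = complex_of_real c)"

definition grad_decomposition ::
    "('n::finite, real) mpol \<Rightarrow> nat \<Rightarrow> (nat \<Rightarrow> (complex ^ 'n) set) \<Rightarrow> bool" where
  "grad_decomposition g s W \<longleftrightarrow>
    V_grad g = (\<Union>j\<in>{0..s}. W j) \<and>
    zariski_closed (W 0) \<and> W 0 \<inter> range complex_vec = {} \<and>
    (\<forall>j\<in>{1..s}. irreducible_variety (W j) \<and> (\<exists>c. const_on g c (W j)))"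

text \<open>
  The regrouping of \<open>W 1, \<dots>, W s\<close>: the values taken by \<open>g\<close> on these components are enumerated
  without repetition as \<open>v 1, \<dots>, v r\<close>, and \<open>W' i\<close> is the union of the components with value \<open>v i\<close>.
\<close>

definition regrouped_decomposition ::
    "('n::finite, real) mpol \<Rightarrow> nat \<Rightarrow> (nat \<Rightarrow> (complex ^ 'n) set) \<Rightarrow>
      nat \<Rightarrow> (nat \<Rightarrow> (complex ^ 'n) set) \<Rightarrow> (nat \<Rightarrow> real) \<Rightarrow> bool" where
  "regrouped_decomposition g s W r W' v \<longleftrightarrow>
    grad_decomposition g s W \<and>
    bij_betw v {1..r} {c. \<exists>j\<in>{1..s}. const_on g c (W j)} \<and>
    (\<forall>i\<in>{1..r}. W' i = \<Union>{W j | j. j \<in> {1..s} \<and> const_on g (v i) (W j)})"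


definition sphere_local_minimizer :: "(real ^ 'n \<Rightarrow> real) \<Rightarrow> real ^ 'n \<Rightarrow> bool" where
  "sphere_local_minimizer F x \<longleftrightarrow>
    x \<in> sphere 0 1 \<and>
    (\<exists>\<epsilon>>0. \<forall>y\<in>sphere 0 1. norm (y - x) < \<epsilon> \<longrightarrow> F x \<le> F y)"

definition sphere_local_minimum :: "(real ^ 'n \<Rightarrow> real) \<Rightarrow> real \<Rightarrow> bool" where
  "sphere_local_minimum F c \<longleftrightarrow> (\<exists>x. sphere_local_minimizer F x \<and> c = F x)"

definition sphere_global_minimum :: "(real ^ 'n \<Rightarrow> real) \<Rightarrow> real \<Rightarrow> bool" where
  "sphere_global_minimum F c \<longleftrightarrow> (\<exists>x\<in>sphere 0 1. c = F x \<and> (\<forall>y\<in>sphere 0 1. F x \<le> F y))"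

definition spurious_negative_local_minimum :: "(real ^ 'n \<Rightarrow> real) \<Rightarrow> real \<Rightarrow> bool" where
  "spurious_negative_local_minimum F c \<longleftrightarrow>
    sphere_local_minimum F c \<and> c < 0 \<and> \<not> sphere_global_minimum F c"


definition g_poly :: "nat \<Rightarrow> ('n::finite, real) mpol \<Rightarrow> ('n, real) mpol" where
  "g_poly d f = f * (1 - mp_const (real d / (real d + 2)) * (\<Sum>i\<in>UNIV. mp_var i ^ 2))"

definition Omega :: "('n::finite, real) mpol \<Rightarrow> (real ^ 'n) set" where
  "Omega f = {x \<in> sphere 0 1. mp_eval f x < 0 \<and> eigval 2 (mp_hessian f x) \<ge> - norm (mp_grad f x)}"

end

theory Submission
  imports Defs
begin

text \<open>
  Let \<open>x\<close> be a local minimizer of the form \<open>f\<close> on the unit sphere with \<open>f(x) < 0\<close>. The claim follows once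
  \<open>f(x)\<close> is shown to be determined by the data of the decomposition, for a global minimizer is then a
  local minimizer with the same value.

  The first order condition and Euler's identity give \<open>\<nabla>f(x) = d f(x) x\<close>
  (\<open>grad_at_local_minimizer\<close>). The polynomial \<open>g\<close> is built so that, on the sphere, this equation says
  \<open>\<nabla>g(x) = 0\<close> (\<open>grad_g_poly_zero\<close>). So \<open>x\<close> is a real point of the gradient variety of \<open>g\<close>, and lies
  on some \<open>W' i\<close>, where \<open>g\<close> is constant (\<open>real_critical_point_in_regrouped\<close>); moreover
  \<open>g(x) = 2/(d+2) f(x)\<close>.

  The second order condition says \<open>u \<bullet> \<nabla>\<^sup>2f(x) u \<ge> d f(x)\<close> for all unit vectors \<open>u\<close> orthogonal to \<open>x\<close>.
  As this bounds the Hessian on a hyperplane, min-max for eigenvalues (\<open>eigval_2_lower_bound\<close>) gives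
  \<open>\<lambda>\<^sub>2(\<nabla>\<^sup>2f(x)) \<ge> d f(x) = - \<parallel>\<nabla>f(x)\<parallel>\<close>, so \<open>x\<close> belongs to \<open>\<Omega>\<close>
  (\<open>negative_local_minimizer_in_Omega\<close>). If only one \<open>W' j\<close> meets \<open>\<Omega>\<close>, then \<open>i = j\<close> for every such \<open>x\<close>,
  and all negative local minima share the value \<open>(d+2)/2 v j\<close>.

  The eigenvalues are defined as roots of the characteristic polynomial; the min-max argument therefore
  rests on the spectral theorem for real symmetric matrices (\<open>symmetric_matrix_eigenbasis\<close>) and the
  resulting factorization of that polynomial (\<open>charpoly_symmetric\<close>).
\<close>

section \<open>Eigenvalues of real symmetric matrices\<close>

lemma linear_term_zero_if_quadratic_nonneg:
  fixes a q :: real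
  assumes "\<And>t. 0 \<le> 2 * t * a + t\<^sup>2 * q"
  shows "a = 0"
proof (rule ccontr)
  assume a: "a \<noteq> 0"
  \<comment> \<open>At \<open>t = - a / K\<close> the linear term is \<open>- 2 a\<^sup>2 / K\<close>, while the quadratic one is at most \<open>a\<^sup>2 / K\<close>.\<close>
  define K where "K = \<bar>q\<bar> + 1"
  have K: "K > 0" "q \<le> K" unfolding K_def by auto
  have "0 \<le> 2 * (- a / K) * a + (- a / K)\<^sup>2 * q" by (rule assms)
  also have "\<dots> \<le> 2 * (- a / K) * a + (- a / K)\<^sup>2 * K"
    using K by (intro add_left_mono mult_left_mono) auto
  also have "\<dots> = - (a\<^sup>2 / K)"
    using K by (simp add: power2_eq_square field_simps)
  also have "\<dots> < 0" using a K by simp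
  finally show False by simp
qed

lemma symmetric_matrix_inner:
  fixes A :: "real ^ 'n ^ 'n"
  assumes "transpose A = A"
  shows "u \<bullet> (A *v w) = (A *v u) \<bullet> w"
  using assms by (metis dot_lmul_matrix vector_transpose_matrix)

text \<open>
  The orthogonal complement of a set of eigenvectors is invariant under \<open>A\<close>. A point \<open>y\<close> minimizing
  the quadratic form on the unit sphere of that complement is an eigenvector: with \<open>m\<close> the minimum,
  \<open>z \<mapsto> z \<bullet> A z - m (z \<bullet> z)\<close> is nonnegative on the complement and vanishes at \<open>y\<close>, so its first
  variation in the direction of the residual \<open>A y - m y\<close> is zero, and that first variation is twice the
  squared norm of the residual.
\<close>

lemma symmetric_matrix_eigenvector_in_complement:
  fixes A :: "real ^ 'n ^ 'n"
  assumes sym: "transpose A = A"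
    and B: "finite B" "card B < CARD('n)"
    and eig: "\<And>b. b \<in> B \<Longrightarrow> \<exists>l. A *v b = l *\<^sub>R b"
  obtains y m where "norm y = 1" "\<And>b. b \<in> B \<Longrightarrow> b \<bullet> y = 0" "A *v y = m *\<^sub>R y"
proof -
  define S where "S = {y. \<forall>b\<in>B. b \<bullet> y = 0}"
  have subS: "subspace S"
    unfolding S_def subspace_def by (auto simp: inner_add_right)
  have "dim B \<le> card B" using B(1) by (rule dim_le_card')
  then have "dim B < DIM(real ^ 'n)" using B(2) by simp
  then have "span B \<noteq> (UNIV :: (real ^ 'n) set)"
    by (metis dim_UNIV dim_span less_irrefl)
  then obtain a where "a \<noteq> 0" "\<forall>b\<in>span B. a \<bullet> b = 0"
    using span_not_UNIV_orthogonal by blast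
  then have "a \<in> S" unfolding S_def by (simp add: inner_commute span_base)
  then have "a /\<^sub>R norm a \<in> S" using subS by (rule subspace_scale[rotated])
  with \<open>a \<noteq> 0\<close> have ne: "S \<inter> sphere 0 1 \<noteq> {}" by (auto intro!: exI[of _ "a /\<^sub>R norm a"])
  have cpt: "compact (S \<inter> sphere 0 1)"
    using closed_subspace[OF subS] by (simp add: closed_Int_compact)
  have "continuous_on (S \<inter> sphere 0 1) (\<lambda>y. y \<bullet> (A *v y))"
    by (intro continuous_intros matrix_vector_mult_linear_continuous_on)
  from continuous_attains_inf[OF cpt ne this]
  obtain y where y: "y \<in> S" "norm y = 1"
    and min: "\<And>z. z \<in> S \<Longrightarrow> norm z = 1 \<Longrightarrow> y \<bullet> (A *v y) \<le> z \<bullet> (A *v z)" by auto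
  define m where "m = y \<bullet> (A *v y)"
  have nonneg: "0 \<le> z \<bullet> (A *v z) - m * (z \<bullet> z)" if "z \<in> S" for z
  proof (cases "z = 0")
    case False
    have "m \<le> (z /\<^sub>R norm z) \<bullet> (A *v (z /\<^sub>R norm z))"
      unfolding m_def using that False by (intro min subspace_scale[OF subS]) auto
    also have "\<dots> = (z \<bullet> (A *v z)) / (z \<bullet> z)"
      by (simp add: matrix_vector_mult_scaleR dot_square_norm power2_eq_square divide_simps)
    finally show ?thesis using False by (simp add: pos_le_divide_eq)
  qed simp
  define w where "w = A *v y - m *\<^sub>R y"
  have "b \<bullet> w = 0" if bB: "b \<in> B" for b
  proof -
    obtain l where "A *v b = l *\<^sub>R b" using eig[OF bB] by blast
    then have "b \<bullet> (A *v y) = l * (b \<bullet> y)" using symmetric_matrix_inner[OF sym, of b y] by simp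
    then show ?thesis using y(1) bB by (simp add: w_def S_def inner_diff_right)
  qed
  then have wS: "w \<in> S" by (simp add: S_def)
  have "w \<bullet> w = 0"
  proof (rule linear_term_zero_if_quadratic_nonneg)
    fix t :: real
    have yw: "y \<bullet> (A *v w) = w \<bullet> (A *v y)"
      using symmetric_matrix_inner[OF sym, of y w] by (simp add: inner_commute)
    have "y + t *\<^sub>R w \<in> S" using subS y(1) wS by (simp add: subspace_add subspace_scale)
    from nonneg[OF this]
    have "0 \<le> (y \<bullet> (A *v y) - m * (y \<bullet> y)) + 2 * t * (w \<bullet> (A *v y) - m * (w \<bullet> y))
        + t\<^sup>2 * (w \<bullet> (A *v w) - m * (w \<bullet> w))"
      by (simp add: matrix_vector_right_distrib matrix_vector_mult_scaleR inner_add_left inner_add_right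
          yw algebra_simps power2_eq_square inner_commute)
    moreover have "y \<bullet> (A *v y) - m * (y \<bullet> y) = 0"
      using y(2) by (simp add: m_def dot_square_norm)
    moreover have "w \<bullet> (A *v y) - m * (w \<bullet> y) = w \<bullet> w"
      by (simp add: w_def inner_diff_right inner_diff_left)
    ultimately show "0 \<le> 2 * t * (w \<bullet> w) + t\<^sup>2 * (w \<bullet> (A *v w) - m * (w \<bullet> w))" by simp
  qed
  then have "A *v y = m *\<^sub>R y" by (simp add: w_def)
  with y that show thesis by (auto simp: S_def)
qed

lemma symmetric_matrix_orthonormal_eigenvectors:
  fixes A :: "real ^ 'n ^ 'n"
  assumes sym: "transpose A = A" and "k \<le> CARD('n)"
  shows "\<exists>B. finite B \<and> card B = k \<and> pairwise orthogonal B \<and>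
    (\<forall>b\<in>B. norm b = 1 \<and> (\<exists>l. A *v b = l *\<^sub>R b))"
  using \<open>k \<le> CARD('n)\<close>
proof (induction k)
  case 0
  then show ?case by (intro exI[of _ "{}"]) auto
next
  case (Suc k)
  then obtain B where B: "finite B" "card B = k" "pairwise orthogonal B"
    "\<And>b. b \<in> B \<Longrightarrow> norm b = 1" "\<And>b. b \<in> B \<Longrightarrow> \<exists>l. A *v b = l *\<^sub>R b" by auto
  obtain y m where y: "norm y = 1" "\<And>b. b \<in> B \<Longrightarrow> b \<bullet> y = 0" "A *v y = m *\<^sub>R y"
    using symmetric_matrix_eigenvector_in_complement[OF sym B(1) _ B(5)] B(2) Suc.prems by auto
  have "y \<notin> B" using y(1) y(2)[of y] by (auto simp: dot_square_norm)
  moreover have "pairwise orthogonal (insert y B)"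
    using B(3) y(2) by (auto simp: pairwise_insert orthogonal_def inner_commute)
  ultimately show ?case using B y by (intro exI[of _ "insert y B"]) auto
qed

text \<open>
  The spectral theorem, with the eigenvectors indexed by the coordinate type so that they can serve as
  the rows of a square matrix.
\<close>

theorem symmetric_matrix_eigenbasis:
  fixes A :: "real ^ 'n ^ 'n"
  assumes "transpose A = A"
  obtains p :: "'n \<Rightarrow> real ^ 'n" and l :: "'n \<Rightarrow> real"
  where "\<And>i j. p i \<bullet> p j = (if i = j then 1 else 0)" "\<And>i. A *v p i = l i *\<^sub>R p i"
proof -
  obtain B where B: "finite B" "card B = CARD('n)" "pairwise orthogonal B"
    and nrm: "\<And>b. b \<in> B \<Longrightarrow> norm b = 1" and eig: "\<And>b. b \<in> B \<Longrightarrow> \<exists>l. A *v b = l *\<^sub>R b"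
    using symmetric_matrix_orthonormal_eigenvectors[OF assms order_refl] by auto
  obtain p :: "'n \<Rightarrow> real ^ 'n" where p: "bij_betw p UNIV B"
    using B by (metis finite_same_card_bij finite_code)
  have pB: "p i \<in> B" for i using p by (auto simp: bij_betw_def)
  have "p i \<bullet> p j = (if i = j then 1 else 0)" for i j
  proof (cases "i = j")
    case True
    then show ?thesis using nrm[OF pB] by (simp add: dot_square_norm)
  next
    case False
    then have "p i \<noteq> p j" using p by (auto simp: bij_betw_def inj_on_def)
    then show ?thesis using B(3) pB False by (simp add: pairwise_def orthogonal_def)
  qed
  moreover obtain l where "\<And>i. A *v p i = l i *\<^sub>R p i" using eig[OF pB] by metis
  ultimately show thesis using that by blast
qed

definition const_poly_matrix :: "real ^ 'n ^ 'm \<Rightarrow> real poly ^ 'n ^ 'm" where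
  "const_poly_matrix M = (\<chi> i j. [:M $ i $ j:])"

lemma const_poly_sum: "[:sum f S:] = (\<Sum>k\<in>S. [:f k:])"
proof (induction S rule: infinite_finite_induct)
  case (insert a S)
  have "[:sum f (insert a S):] = [:f a:] + [:sum f S:]" using insert.hyps by simp
  also have "\<dots> = (\<Sum>k\<in>insert a S. [:f k:])" by (simp only: insert.IH sum.insert[OF insert.hyps])
  finally show ?case .
qed simp_all

lemma const_poly_matrix_mult:
  "const_poly_matrix (M ** N) = const_poly_matrix M ** const_poly_matrix N"
  by (simp add: const_poly_matrix_def matrix_matrix_mult_def vec_eq_iff const_poly_sum mult.commute)

lemma const_poly_matrix_1: "const_poly_matrix (mat 1) = mat 1"
  by (simp add: const_poly_matrix_def mat_def vec_eq_iff one_pCons)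

text \<open>
  All roots of the characteristic polynomial of a symmetric matrix are real, and their multiplicities are
  visible in an eigenbasis. The change of basis is carried out over the ring of polynomials: if \<open>P\<close> has
  the orthonormal eigenvectors as rows, then \<open>P (X - A) P\<^sup>T\<close> is diagonal with entries \<open>X - l\<^sub>i\<close>.
\<close>

lemma charpoly_symmetric:
  fixes A :: "real ^ 'n ^ 'n" and p :: "'n \<Rightarrow> real ^ 'n"
  assumes orth: "\<And>i j. p i \<bullet> p j = (if i = j then 1 else 0)"
    and eig: "\<And>i. A *v p i = l i *\<^sub>R p i"
  shows "charpoly A = (\<Prod>i\<in>UNIV. [:- l i, 1:])"
proof -
  define P where "P = (\<chi> i. p i)"
  define L where "L = const_poly_matrix P"
  define R where "R = const_poly_matrix (transpose P)"
  define M :: "real poly ^ 'n ^ 'n" where "M = mat [:0, 1:] - const_poly_matrix A"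
  define D :: "real poly ^ 'n ^ 'n" where "D = (\<chi> i j. if i = j then [:- l i, 1:] else 0)"
  have "P ** transpose P = mat 1"
    using orth by (simp add: P_def matrix_matrix_mult_def transpose_def mat_def vec_eq_iff inner_vec_def)
  then have LR: "L ** R = mat 1"
    by (simp add: L_def R_def const_poly_matrix_1 flip: const_poly_matrix_mult)
  \<comment> \<open>Column \<open>j\<close> of this identity says that \<open>p j\<close> is an eigenvector for \<open>l j\<close>.\<close>
  have "M ** R = R ** D"
  proof -
    have AP: "(\<Sum>k\<in>UNIV. A $ i $ k * p j $ k) = l j * p j $ i" for i j
      using eig[of j] by (simp add: matrix_vector_mult_def vec_eq_iff)
    have "(M ** R) $ i $ j = (R ** D) $ i $ j" for i j
    proof -
      have "(M ** R) $ i $ j = (\<Sum>k\<in>UNIV. (if i = k then [:0, 1:] else 0) * [:p j $ k:])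
          - (\<Sum>k\<in>UNIV. [:A $ i $ k * p j $ k:])"
        by (simp add: M_def R_def P_def const_poly_matrix_def matrix_matrix_mult_def mat_def transpose_def
            smult_diff_right sum_subtractf mult.commute)
      also have "(\<Sum>k\<in>UNIV. (if i = k then [:0, 1:] else 0) * [:p j $ k:]) = [:0, p j $ i:]"
        by (simp add: if_distrib[of "smult _"] cong: if_cong)
      also have "(\<Sum>k\<in>UNIV. [:A $ i $ k * p j $ k:]) = [:l j * p j $ i:]"
        using AP by (simp flip: const_poly_sum)
      finally show ?thesis
        by (simp add: D_def R_def P_def const_poly_matrix_def matrix_matrix_mult_def transpose_def
            if_distrib[of "\<lambda>x. _ * x"] mult.commute cong: if_cong)
    qed
    then show ?thesis by (simp add: vec_eq_iff)
  qed
  then have "L ** M ** R = (L ** R) ** D"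
    by (simp only: matrix_mul_assoc[symmetric])
  then have "det D = det L * det M * det R" by (simp add: LR flip: det_mul)
  also have "\<dots> = det (L ** R) * det M" by (simp add: det_mul mult_ac)
  finally have "det M = det D" by (simp add: LR)
  also have "\<dots> = (\<Prod>i\<in>UNIV. [:- l i, 1:])" by (subst det_diagonal) (auto simp: D_def)
  also have "M = (\<chi> i j. (if i = j then [:0, 1:] else 0) - [:A $ i $ j:])"
    by (simp add: M_def mat_def const_poly_matrix_def vec_eq_iff)
  finally show ?thesis by (simp add: charpoly_def)
qed

text \<open>
  One half of the Courant-Fischer principle. Two eigenvectors with eigenvalues below \<open>c\<close> would span a
  plane on which the quadratic form lies below \<open>c\<close>, and every plane meets the hyperplane orthogonal to
  \<open>x\<close> in a nonzero vector. So at most one eigenvalue, counted with multiplicity, lies below \<open>c\<close>.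
\<close>

lemma eigval_2_lower_bound:
  fixes A :: "real ^ 'n ^ 'n"
  assumes sym: "transpose A = A" and n: "CARD('n) \<ge> 2"
    and pos: "\<And>u. u \<bullet> x = 0 \<Longrightarrow> c * (u \<bullet> u) \<le> u \<bullet> (A *v u)"
  shows "c \<le> eigval 2 A"
proof (rule ccontr)
  assume less: "\<not> c \<le> eigval 2 A"
  obtain p :: "'n \<Rightarrow> real ^ 'n" and l
    where orth: "\<And>i j. p i \<bullet> p j = (if i = j then 1 else 0)" and eig: "\<And>i. A *v p i = l i *\<^sub>R p i"
    using symmetric_matrix_eigenbasis[OF sym] by blast
  have "proots (charpoly A) = (\<Sum>i\<in>UNIV. {#l i#})"
    using charpoly_symmetric[OF orth eig] by (simp add: proots_prod)
  also have "\<dots> = image_mset l (mset_set UNIV)"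
    by (simp add: sum_unfold_sum_mset)
  finally have roots: "proots (charpoly A) = image_mset l (mset_set UNIV)" .
  define xs where "xs = sorted_list_of_multiset (proots (charpoly A))"
  have mset_xs: "mset xs = image_mset l (mset_set UNIV)" by (simp add: xs_def roots)
  then have "length xs = CARD('n)" by (metis size_image_mset size_mset size_mset_set)
  then obtain a b ys where xs: "xs = a # b # ys"
    using n by (cases xs; cases "tl xs") auto
  have "sorted xs" by (simp add: xs_def sorted_sorted_list_of_multiset)
  then have "a < c" "b < c" using less unfolding eigval_def xs_def[symmetric] by (auto simp: xs)
  then have "2 \<le> size (filter_mset (\<lambda>t. t < c) (mset xs))" by (simp add: xs)
  also have "\<dots> = card {i. l i < c}"
    by (simp add: mset_xs filter_mset_image_mset)
  finally obtain i j where ij: "i \<noteq> j" "l i < c" "l j < c"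
    by (auto simp: numeral_2_eq_2 card_le_Suc_iff)
  \<comment> \<open>Coefficients of a nonzero vector orthogonal to \<open>x\<close> in the plane of the two eigenvectors.\<close>
  obtain \<alpha> \<beta> where ab: "\<alpha> * (p i \<bullet> x) + \<beta> * (p j \<bullet> x) = 0" "\<alpha> \<noteq> 0 \<or> \<beta> \<noteq> 0"
  proof (cases "p j \<bullet> x = 0")
    case True
    then show thesis using that[of 0 1] by simp
  next
    case False
    then show thesis using that[of "p j \<bullet> x" "- (p i \<bullet> x)"] by simp
  qed
  define u where "u = \<alpha> *\<^sub>R p i + \<beta> *\<^sub>R p j"
  have uu: "u \<bullet> u = \<alpha>\<^sup>2 + \<beta>\<^sup>2"
    using ij(1) by (simp add: u_def inner_add_left inner_add_right orth power2_eq_square)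
  have uAu: "u \<bullet> (A *v u) = \<alpha>\<^sup>2 * l i + \<beta>\<^sup>2 * l j"
    using ij(1) by (simp add: u_def inner_add_left inner_add_right orth power2_eq_square
        matrix_vector_right_distrib matrix_vector_mult_scaleR eig algebra_simps)
  have "c * (\<alpha>\<^sup>2 + \<beta>\<^sup>2) \<le> \<alpha>\<^sup>2 * l i + \<beta>\<^sup>2 * l j"
    using pos[of u] ab(1) by (simp add: uu uAu) (simp add: u_def inner_add_left)
  then have "\<alpha>\<^sup>2 * (c - l i) + \<beta>\<^sup>2 * (c - l j) \<le> 0" by (simp add: algebra_simps)
  moreover have "0 < \<alpha>\<^sup>2 * (c - l i) + \<beta>\<^sup>2 * (c - l j)"
  proof (cases "\<alpha> = 0")
    case True
    then show ?thesis using ab(2) ij by simp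
  next
    case False
    then show ?thesis using ij by (intro add_pos_nonneg) simp_all
  qed
  ultimately show False by simp
qed

section \<open>Evaluation and formal derivatives of polynomials\<close>

definition mp_monom :: "('n::finite \<Rightarrow>\<^sub>0 nat) \<Rightarrow> 'a::comm_semiring_1 ^ 'n \<Rightarrow> 'a" where
  "mp_monom m z = (\<Prod>i\<in>UNIV. (z $ i) ^ Poly_Mapping.lookup m i)"

lemma mp_monom_0 [simp]: "mp_monom 0 z = 1"
  by (simp add: mp_monom_def)

lemma mp_monom_add: "mp_monom (m + k) z = mp_monom m z * mp_monom k z"
  by (simp add: mp_monom_def lookup_add power_add prod.distrib)

lemma mp_monom_single: "mp_monom (Poly_Mapping.single i k) z = (z $ i) ^ k"
proof -
  have "mp_monom (Poly_Mapping.single i k) z = (\<Prod>j\<in>UNIV. if j = i then (z $ i) ^ k else 1)"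
    unfolding mp_monom_def by (intro prod.cong) (auto simp: lookup_single)
  then show ?thesis by simp
qed

lemma mp_eval_eq_sum_superset:
  assumes "finite S" "Poly_Mapping.keys p \<subseteq> S"
  shows "mp_eval p z = (\<Sum>m\<in>S. Poly_Mapping.lookup p m * mp_monom m z)"
  unfolding mp_eval_def mp_monom_def[symmetric]
  using assms by (intro sum.mono_neutral_left) (auto simp: in_keys_iff)

lemma mp_eval_0 [simp]: "mp_eval 0 z = 0"
  by (simp add: mp_eval_def)

lemma mp_eval_single: "mp_eval (Poly_Mapping.single m c) z = c * mp_monom m z"
  by (subst mp_eval_eq_sum_superset[of "{m}"]) auto

lemma mp_eval_add: "mp_eval (p + q) z = mp_eval p z + mp_eval q z"
proof -
  let ?S = "Poly_Mapping.keys p \<union> Poly_Mapping.keys q"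
  have "finite ?S" "Poly_Mapping.keys (p + q) \<subseteq> ?S" by (auto simp: Poly_Mapping.keys_add)
  then show ?thesis
    by (simp add: mp_eval_eq_sum_superset[of ?S] lookup_add distrib_right sum.distrib)
qed

lemma mp_eval_sum: "mp_eval (sum f S) z = (\<Sum>k\<in>S. mp_eval (f k) z)"
  by (induction S rule: infinite_finite_induct) (simp_all add: mp_eval_add)

lemma mpol_eq_sum_single:
  "p = (\<Sum>m\<in>Poly_Mapping.keys p. Poly_Mapping.single m (Poly_Mapping.lookup p m))"
proof (rule poly_mapping_eqI)
  fix k
  show "Poly_Mapping.lookup p k = Poly_Mapping.lookup
      (\<Sum>m\<in>Poly_Mapping.keys p. Poly_Mapping.single m (Poly_Mapping.lookup p m)) k"
    by (simp add: lookup_sum lookup_single when_def sum.delta in_keys_iff)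
qed

lemma mp_eval_mult: "mp_eval (p * q) z = mp_eval p z * mp_eval q z"
proof -
  have "p * q = (\<Sum>m\<in>Poly_Mapping.keys p. \<Sum>k\<in>Poly_Mapping.keys q.
      Poly_Mapping.single (m + k) (Poly_Mapping.lookup p m * Poly_Mapping.lookup q k))"
    by (subst (1) mpol_eq_sum_single[of p], subst (1) mpol_eq_sum_single[of q])
      (simp only: sum_product mult_single)
  then have "mp_eval (p * q) z = (\<Sum>m\<in>Poly_Mapping.keys p. \<Sum>k\<in>Poly_Mapping.keys q.
      (Poly_Mapping.lookup p m * mp_monom m z) * (Poly_Mapping.lookup q k * mp_monom k z))"
    by (simp add: mp_eval_sum mp_eval_single mp_monom_add mult_ac)
  then show ?thesis
    by (simp add: mp_eval_def sum_product flip: mp_monom_def)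
qed

lemma mp_eval_1 [simp]: "mp_eval 1 z = 1"
  by (metis mp_eval_single mp_monom_0 mult_1 single_one)

lemma mp_eval_const: "mp_eval (mp_const c) z = c"
  by (simp add: mp_const_def mp_eval_single)

lemma mp_eval_var: "mp_eval (mp_var i) z = z $ i"
  by (simp add: mp_var_def mp_eval_single mp_monom_single)

lemma mp_eval_diff:
  fixes p q :: "('n::finite, 'a::comm_ring_1) mpol"
  shows "mp_eval (p - q) z = mp_eval p z - mp_eval q z"
  using mp_eval_add[of "p - q" q z] by simp

text \<open>
  This description reduces the commutation of partial derivatives with each other and with
  complexification to a comparison of coefficients.
\<close>

lemma lookup_mp_partial:
  "Poly_Mapping.lookup (mp_partial i p) m =
    of_nat (Poly_Mapping.lookup m i + 1) * Poly_Mapping.lookup p (m + Poly_Mapping.single i 1)"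
proof -
  let ?e = "Poly_Mapping.single i (1::nat)"
  have *: "(of_nat (Poly_Mapping.lookup k i) * Poly_Mapping.lookup p k when k - ?e = m)
      = (of_nat (Poly_Mapping.lookup k i) * Poly_Mapping.lookup p k when k = m + ?e)" for k
  proof (cases "Poly_Mapping.lookup k i = 0")
    \<comment> \<open>If \<open>i\<close> does not occur in \<open>k\<close>, subtraction truncates, but then the coefficient is zero.\<close>
    case False
    then have "k - ?e + ?e = k"
      by (intro poly_mapping_eqI) (auto simp: lookup_add lookup_minus lookup_single when_def)
    then have "k - ?e = m \<longleftrightarrow> k = m + ?e" by (metis add_diff_cancel_right')
    then show ?thesis by simp
  qed simp
  have "Poly_Mapping.lookup (mp_partial i p) m = (\<Sum>k\<in>Poly_Mapping.keys p.
      (of_nat (Poly_Mapping.lookup k i) * Poly_Mapping.lookup p k when k = m + ?e))"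
    by (simp add: mp_partial_def lookup_sum lookup_single * del: One_nat_def)
  also have "\<dots> = of_nat (Poly_Mapping.lookup m i + 1) * Poly_Mapping.lookup p (m + ?e)"
    by (auto simp: when_def sum.delta lookup_add lookup_single in_keys_iff)
  finally show ?thesis .
qed

lemma mp_partial_commute: "mp_partial i (mp_partial j p) = mp_partial j (mp_partial i p)"
proof (cases "i = j")
  case False
  show ?thesis
  proof (rule poly_mapping_eqI)
    fix m
    show "Poly_Mapping.lookup (mp_partial i (mp_partial j p)) m =
        Poly_Mapping.lookup (mp_partial j (mp_partial i p)) m"
      using False by (simp add: lookup_mp_partial lookup_add lookup_single mult_ac add_ac del: of_nat_add of_nat_Suc)
  qed
qed simp

lemma transpose_mp_hessian: "transpose (mp_hessian p z) = mp_hessian p z"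
  by (simp add: transpose_def mp_hessian_def vec_eq_iff mp_partial_commute)

lemma mp_eval_partial:
  "mp_eval (mp_partial i p) z = (\<Sum>m\<in>Poly_Mapping.keys p. Poly_Mapping.lookup p m *
    (of_nat (Poly_Mapping.lookup m i) * mp_monom (m - Poly_Mapping.single i 1) z))"
  by (simp add: mp_partial_def mp_eval_sum mp_eval_single mult_ac)

lemma Euler_identity:
  fixes p :: "('n::finite, 'a::comm_semiring_1) mpol"
  assumes "is_form d p"
  shows "(\<Sum>i\<in>UNIV. z $ i * mp_grad p z $ i) = of_nat d * mp_eval p z"
proof -
  have *: "z $ i * (of_nat (Poly_Mapping.lookup m i) * mp_monom (m - Poly_Mapping.single i 1) z)
      = of_nat (Poly_Mapping.lookup m i) * mp_monom m z" for i m
  proof (cases "Poly_Mapping.lookup m i = 0")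
    case False
    then have "m = m - Poly_Mapping.single i 1 + Poly_Mapping.single i 1"
      by (intro poly_mapping_eqI) (auto simp: lookup_add lookup_minus lookup_single when_def)
    then have "mp_monom m z = mp_monom (m - Poly_Mapping.single i 1) z * z $ i"
      using mp_monom_add mp_monom_single by (metis power_one_right)
    then show ?thesis by (simp add: mult_ac)
  qed simp
  have "(\<Sum>i\<in>UNIV. z $ i * mp_grad p z $ i) = (\<Sum>i\<in>UNIV. \<Sum>m\<in>Poly_Mapping.keys p.
      Poly_Mapping.lookup p m * (z $ i * (of_nat (Poly_Mapping.lookup m i) * mp_monom (m - Poly_Mapping.single i 1) z)))"
    by (simp add: mp_grad_def mp_eval_partial sum_distrib_left mult_ac)
  also have "\<dots> = (\<Sum>m\<in>Poly_Mapping.keys p. \<Sum>i\<in>UNIV. 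
      Poly_Mapping.lookup p m * (of_nat (Poly_Mapping.lookup m i) * mp_monom m z))"
    unfolding * by (rule sum.swap)
  also have "\<dots> = (\<Sum>m\<in>Poly_Mapping.keys p. Poly_Mapping.lookup p m * (of_nat d * mp_monom m z))"
  proof (rule sum.cong[OF refl])
    fix m assume "m \<in> Poly_Mapping.keys p"
    then have "of_nat d = (\<Sum>i\<in>UNIV. of_nat (Poly_Mapping.lookup m i) :: 'a)"
      using assms unfolding is_form_def by (metis of_nat_sum)
    then show "(\<Sum>i\<in>UNIV. Poly_Mapping.lookup p m * (of_nat (Poly_Mapping.lookup m i) * mp_monom m z))
        = Poly_Mapping.lookup p m * (of_nat d * mp_monom m z)"
      by (simp only: sum_distrib_left sum_distrib_right)
  qed
  also have "\<dots> = of_nat d * mp_eval p z"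
    by (simp add: mp_eval_def sum_distrib_left mult_ac flip: mp_monom_def)
  finally show ?thesis .
qed

lemma mp_monom_has_derivative_along_curve:
  fixes \<gamma> :: "real \<Rightarrow> real ^ 'n"
  assumes \<gamma>: "\<And>i. ((\<lambda>t. \<gamma> t $ i) has_real_derivative \<gamma>' $ i) (at t)"
  shows "((\<lambda>t. mp_monom m (\<gamma> t)) has_real_derivative
    (\<Sum>i\<in>UNIV. of_nat (Poly_Mapping.lookup m i) * mp_monom (m - Poly_Mapping.single i 1) (\<gamma> t) * \<gamma>' $ i)) (at t)"
proof -
  let ?l = "Poly_Mapping.lookup m"
  have "((\<lambda>t. \<Prod>i\<in>UNIV. (\<gamma> t $ i) ^ ?l i) has_real_derivative
      (\<Sum>i\<in>UNIV. (real (?l i) * (\<gamma> t $ i) ^ (?l i - 1) * \<gamma>' $ i) * (\<Prod>j\<in>UNIV - {i}. (\<gamma> t $ j) ^ ?l j))) (at t)"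
    by (rule has_field_derivative_prod) (auto intro!: derivative_eq_intros \<gamma>)
  moreover have "mp_monom (m - Poly_Mapping.single i 1) (\<gamma> t) =
      (\<gamma> t $ i) ^ (?l i - 1) * (\<Prod>j\<in>UNIV - {i}. (\<gamma> t $ j) ^ ?l j)" for i
  proof -
    have "mp_monom (m - Poly_Mapping.single i 1) (\<gamma> t) = (\<gamma> t $ i) ^ (?l i - 1) *
        (\<Prod>j\<in>UNIV - {i}. (\<gamma> t $ j) ^ Poly_Mapping.lookup (m - Poly_Mapping.single i 1) j)"
      unfolding mp_monom_def by (subst prod.remove[of _ i]) (simp_all add: lookup_minus)
    also have "(\<Prod>j\<in>UNIV - {i}. (\<gamma> t $ j) ^ Poly_Mapping.lookup (m - Poly_Mapping.single i 1) j)
        = (\<Prod>j\<in>UNIV - {i}. (\<gamma> t $ j) ^ ?l j)"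
      by (intro prod.cong) (auto simp: lookup_minus lookup_single)
    finally show ?thesis .
  qed
  ultimately show ?thesis by (simp add: mult_ac flip: mp_monom_def)
qed

text \<open>
  The chain rule linking the formal gradient to analysis. Applied to the partial derivatives
  it also yields second derivatives, so curves suffice for the optimality conditions and for \<open>\<nabla>g\<close>.
\<close>

lemma mp_eval_has_derivative_along_curve:
  fixes \<gamma> :: "real \<Rightarrow> real ^ 'n"
  assumes \<gamma>: "\<And>i. ((\<lambda>t. \<gamma> t $ i) has_real_derivative \<gamma>' $ i) (at t)"
  shows "((\<lambda>t. mp_eval p (\<gamma> t)) has_real_derivative mp_grad p (\<gamma> t) \<bullet> \<gamma>') (at t)"
proof -
  have "((\<lambda>t. mp_eval p (\<gamma> t)) has_real_derivative (\<Sum>m\<in>Poly_Mapping.keys p. Poly_Mapping.lookup p m *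
     (\<Sum>i\<in>UNIV. of_nat (Poly_Mapping.lookup m i) * mp_monom (m - Poly_Mapping.single i 1) (\<gamma> t) * \<gamma>' $ i))) (at t)"
    unfolding mp_eval_def mp_monom_def[symmetric]
    by (intro DERIV_sum DERIV_cmult mp_monom_has_derivative_along_curve \<gamma>)
  also have "(\<Sum>m\<in>Poly_Mapping.keys p. Poly_Mapping.lookup p m *
     (\<Sum>i\<in>UNIV. of_nat (Poly_Mapping.lookup m i) * mp_monom (m - Poly_Mapping.single i 1) (\<gamma> t) * \<gamma>' $ i))
     = mp_grad p (\<gamma> t) \<bullet> \<gamma>'"
    unfolding inner_vec_def mp_grad_def
    by (simp add: mp_eval_partial sum_distrib_left sum_distrib_right mult_ac) (rule sum.swap)
  finally show ?thesis .
qed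

lemma continuous_on_mp_eval: "continuous_on S (mp_eval (p :: ('n::finite, real) mpol))"
  unfolding mp_eval_def by (intro continuous_intros)

lemma lookup_complexify: "Poly_Mapping.lookup (complexify p) m = complex_of_real (Poly_Mapping.lookup p m)"
  by (simp add: complexify_def Poly_Mapping.map.rep_eq when_def)

lemma complexify_partial: "mp_partial i (complexify p) = complexify (mp_partial i p)"
  by (rule poly_mapping_eqI) (simp add: lookup_mp_partial lookup_complexify)

lemma mp_eval_complexify: "mp_eval (complexify p) (complex_vec x) = complex_of_real (mp_eval p x)"
proof -
  have "Poly_Mapping.keys (complexify p) = Poly_Mapping.keys p"
    by (auto simp: in_keys_iff lookup_complexify)
  then show ?thesis by (simp add: mp_eval_def lookup_complexify complex_vec_def)
qed

lemma complex_vec_in_V_grad_iff: "complex_vec x \<in> V_grad g \<longleftrightarrow> mp_grad g x = 0"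
  by (simp add: V_grad_def mp_grad_def vec_eq_iff complexify_partial mp_eval_complexify)

section \<open>Optimality conditions on the sphere\<close>

text \<open>
  If the second derivative were negative, the first one would be negative just to the right of the
  critical point, and the function would decrease there.
\<close>

lemma second_derivative_nonneg_at_local_min:
  fixes \<phi> \<phi>' :: "real \<Rightarrow> real"
  assumes d1: "\<And>t. (\<phi> has_real_derivative \<phi>' t) (at t)"
    and d2: "(\<phi>' has_real_derivative D) (at a)"
    and min: "\<forall>\<^sub>F t in at a. \<phi> a \<le> \<phi> t"
  shows "\<phi>' a = 0" "0 \<le> D"
proof -
  obtain e where e: "e > 0" "\<And>t. t \<noteq> a \<Longrightarrow> \<bar>t - a\<bar> < e \<Longrightarrow> \<phi> a \<le> \<phi> t"
    using min unfolding eventually_at by (auto simp: dist_real_def)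
  show z: "\<phi>' a = 0"
    using DERIV_local_min[OF d1 e(1)] e(2) by (metis abs_minus_commute order_refl)
  show "0 \<le> D"
  proof (rule ccontr)
    assume "\<not> 0 \<le> D"
    then obtain r where r: "r > 0" "\<And>h. 0 < h \<Longrightarrow> h < r \<Longrightarrow> \<phi>' (a + h) < \<phi>' a"
      using DERIV_neg_dec_right[OF d2] by auto
    define h where "h = min r e / 2"
    have h: "0 < h" "h < r" "h < e" using r(1) e(1) by (auto simp: h_def)
    obtain s where s: "a < s" "s < a + h" "\<phi> (a + h) - \<phi> a = (a + h - a) * \<phi>' s"
      using MVT2[of a "a + h" \<phi> \<phi>'] h(1) d1 by auto
    have "\<phi>' s < 0" using r(2)[of "s - a"] s h z by simp
    then have "h * \<phi>' s < 0" using h(1) by (rule mult_pos_neg[rotated])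
    then have "\<phi> (a + h) < \<phi> a" using s(3) by simp
    then show False using e(2)[of "a + h"] h by simp
  qed
qed

lemma mp_eval_second_derivative_along_curve:
  fixes \<gamma> \<gamma>' :: "real \<Rightarrow> real ^ 'n"
  assumes \<gamma>: "\<And>i. ((\<lambda>t. \<gamma> t $ i) has_real_derivative \<gamma>' t $ i) (at t)"
    and \<gamma>': "\<And>i. ((\<lambda>t. \<gamma>' t $ i) has_real_derivative \<gamma>'' $ i) (at t)"
  shows "((\<lambda>t. mp_grad p (\<gamma> t) \<bullet> \<gamma>' t) has_real_derivative
    \<gamma>' t \<bullet> (mp_hessian p (\<gamma> t) *v \<gamma>' t) + mp_grad p (\<gamma> t) \<bullet> \<gamma>'') (at t)"
proof -
  have "((\<lambda>t. \<Sum>i\<in>UNIV. mp_eval (mp_partial i p) (\<gamma> t) * \<gamma>' t $ i) has_real_derivative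
      (\<Sum>i\<in>UNIV. mp_eval (mp_partial i p) (\<gamma> t) * \<gamma>'' $ i
        + (mp_grad (mp_partial i p) (\<gamma> t) \<bullet> \<gamma>' t) * \<gamma>' t $ i)) (at t)"
    by (intro DERIV_sum DERIV_mult' mp_eval_has_derivative_along_curve \<gamma> \<gamma>')
  moreover have "mp_eval (mp_partial j (mp_partial i p)) (\<gamma> t) = mp_hessian p (\<gamma> t) $ i $ j" for i j
    by (simp add: mp_hessian_def mp_partial_commute[of i])
  ultimately show ?thesis
    by (simp add: inner_vec_def mp_grad_def sum.distrib matrix_vector_mult_def mult_ac add_ac)
qed

text \<open>
  First and second order conditions on the sphere, read off along the great circle
  \<open>\<gamma> t = cos t x + sin t u\<close>. As \<open>\<gamma>'' 0 = - x\<close>, the curvature of the circle contributes the term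
  \<open>- x \<bullet> \<nabla>p(x)\<close> to the second derivative of \<open>p \<circ> \<gamma>\<close> at \<open>0\<close>.
\<close>

lemma sphere_local_minimizer_conditions:
  fixes p :: "('n::finite, real) mpol"
  assumes x: "sphere_local_minimizer (mp_eval p) x" and u: "u \<bullet> x = 0" "norm u = 1"
  shows "mp_grad p x \<bullet> u = 0" "x \<bullet> mp_grad p x \<le> u \<bullet> (mp_hessian p x *v u)"
proof -
  define \<gamma> where "\<gamma> t = cos t *\<^sub>R x + sin t *\<^sub>R u" for t
  define \<gamma>' where "\<gamma>' t = - sin t *\<^sub>R x + cos t *\<^sub>R u" for t
  have d\<gamma>: "((\<lambda>t. \<gamma> t $ i) has_real_derivative \<gamma>' t $ i) (at t)" for i t
    unfolding \<gamma>_def \<gamma>'_def by (auto intro!: derivative_eq_intros)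
  have d\<gamma>': "((\<lambda>t. \<gamma>' t $ i) has_real_derivative (- x) $ i) (at 0)" for i
    unfolding \<gamma>'_def by (auto intro!: derivative_eq_intros)
  have \<gamma>0: "\<gamma> 0 = x" "\<gamma>' 0 = u" by (simp_all add: \<gamma>_def \<gamma>'_def)
  obtain e where nx: "norm x = 1" and e: "e > 0"
    "\<And>y. norm y = 1 \<Longrightarrow> norm (y - x) < e \<Longrightarrow> mp_eval p x \<le> mp_eval p y"
    using x by (auto simp: sphere_local_minimizer_def)
  have "norm (\<gamma> t) = 1" for t
  proof -
    have "\<gamma> t \<bullet> \<gamma> t = (cos t)\<^sup>2 * (x \<bullet> x) + (sin t)\<^sup>2 * (u \<bullet> u)"
      using u(1) by (simp add: \<gamma>_def inner_add_left inner_add_right inner_commute[of x u] power2_eq_square)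
    then show ?thesis using nx u(2) by (simp add: dot_square_norm norm_eq_1)
  qed
  moreover have "(\<gamma> \<longlongrightarrow> \<gamma> 0) (at 0)"
    unfolding \<gamma>_def by (intro tendsto_intros)
  then have "\<forall>\<^sub>F t in at 0. norm (\<gamma> t - x) < e"
    using e(1) by (simp add: tendsto_iff \<gamma>0 dist_norm)
  ultimately have "\<forall>\<^sub>F t in at 0. mp_eval p (\<gamma> 0) \<le> mp_eval p (\<gamma> t)"
    by (auto simp: \<gamma>0 elim!: eventually_mono intro!: e(2))
  from second_derivative_nonneg_at_local_min[OF mp_eval_has_derivative_along_curve[OF d\<gamma>]
      mp_eval_second_derivative_along_curve[OF d\<gamma> d\<gamma>'] this]
  show "mp_grad p x \<bullet> u = 0" "x \<bullet> mp_grad p x \<le> u \<bullet> (mp_hessian p x *v u)"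
    by (simp_all add: \<gamma>0 inner_commute)
qed

context
  fixes f :: "('n::finite, real) mpol" and d :: nat and x :: "real ^ 'n"
  assumes form: "is_form d f" and x: "sphere_local_minimizer (mp_eval f) x"
begin

lemma inner_grad_form: "x \<bullet> mp_grad f x = real d * mp_eval f x"
  using Euler_identity[OF form, of x] by (simp add: inner_vec_def)

text \<open>
  The gradient is orthogonal to every tangent direction, hence a multiple of \<open>x\<close>; Euler's identity
  determines the multiplier.
\<close>

lemma grad_at_local_minimizer: "mp_grad f x = (real d * mp_eval f x) *\<^sub>R x"
proof -
  let ?w = "mp_grad f x - (real d * mp_eval f x) *\<^sub>R x"
  have "x \<bullet> x = 1" using x by (simp add: sphere_local_minimizer_def norm_eq_1)
  then have wx: "?w \<bullet> x = 0" using inner_grad_form by (simp add: inner_diff_left inner_diff_right inner_commute)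
  have "?w = 0"
  proof (rule ccontr)
    assume w: "?w \<noteq> 0"
    then have "mp_grad f x \<bullet> (?w /\<^sub>R norm ?w) = 0"
      using wx by (intro sphere_local_minimizer_conditions(1)[OF x]) simp_all
    then have "mp_grad f x \<bullet> ?w = 0" using w by simp
    then have "?w \<bullet> ?w = 0" using wx by (simp add: inner_diff_left inner_diff_right inner_commute)
    then show False using w by simp
  qed
  then show ?thesis by simp
qed

text \<open>
  By the second order condition the Hessian is bounded below by \<open>d f(x)\<close> on the hyperplane orthogonal to
  \<open>x\<close>. Since \<open>\<nabla>f(x) = d f(x) x\<close> and \<open>f(x) < 0\<close>, this bound is exactly \<open>- \<parallel>\<nabla>f(x)\<parallel>\<close>.
\<close>

lemma negative_local_minimizer_in_Omega:
  assumes "CARD('n) \<ge> 2" and neg: "mp_eval f x < 0"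
  shows "x \<in> Omega f"
proof -
  have nx: "norm x = 1" using x by (simp add: sphere_local_minimizer_def)
  have "real d * mp_eval f x \<le> eigval 2 (mp_hessian f x)"
  proof (rule eigval_2_lower_bound[OF transpose_mp_hessian assms(1)])
    fix u :: "real ^ 'n" assume u: "u \<bullet> x = 0"
    show "real d * mp_eval f x * (u \<bullet> u) \<le> u \<bullet> (mp_hessian f x *v u)"
    proof (cases "u = 0")
      case False
      define w where "w = u /\<^sub>R norm u"
      have "real d * mp_eval f x \<le> w \<bullet> (mp_hessian f x *v w)"
        using sphere_local_minimizer_conditions(2)[OF x, of w] u False by (simp add: inner_grad_form w_def)
      also have "w \<bullet> (mp_hessian f x *v w) = u \<bullet> (mp_hessian f x *v u) / (u \<bullet> u)"
        by (simp add: w_def matrix_vector_mult_scaleR dot_square_norm power2_eq_square divide_simps)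
      finally show ?thesis using False by (simp add: pos_le_divide_eq)
    qed simp
  qed
  moreover have "norm (mp_grad f x) = - (real d * mp_eval f x)"
    using neg by (simp add: grad_at_local_minimizer nx abs_mult)
  ultimately show ?thesis using neg nx by (simp add: Omega_def)
qed

end

section \<open>The gradient variety of \<open>g\<close>\<close>

lemma mp_eval_g_poly:
  "mp_eval (g_poly d f) x = mp_eval f x * (1 - real d / (real d + 2) * (x \<bullet> x))"
  by (simp add: g_poly_def mp_eval_mult mp_eval_diff mp_eval_const mp_eval_sum mp_eval_var
      power2_eq_square inner_vec_def)

lemma mp_grad_g_poly:
  "mp_grad (g_poly d f) x = (1 - real d / (real d + 2) * (x \<bullet> x)) *\<^sub>R mp_grad f x
    - (2 * (real d / (real d + 2)) * mp_eval f x) *\<^sub>R x"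
proof (rule vector_eq_rdot[THEN iffD1], rule allI)
  fix u
  define c where "c = real d / (real d + 2)"
  let ?\<gamma> = "\<lambda>t. x + t *\<^sub>R u"
  have \<gamma>: "((\<lambda>t. ?\<gamma> t $ i) has_real_derivative u $ i) (at 0)" for i
    by (auto intro!: derivative_eq_intros)
  have "((\<lambda>t. x \<bullet> x + t * (2 * (x \<bullet> u)) + t\<^sup>2 * (u \<bullet> u)) has_real_derivative 2 * (x \<bullet> u)) (at 0)"
    by (auto intro!: derivative_eq_intros)
  moreover have "(\<lambda>t. ?\<gamma> t \<bullet> ?\<gamma> t) = (\<lambda>t. x \<bullet> x + t * (2 * (x \<bullet> u)) + t\<^sup>2 * (u \<bullet> u))"
    by (rule ext) (simp add: inner_add_left inner_add_right inner_commute[of u x] power2_eq_square algebra_simps)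
  ultimately have "((\<lambda>t. ?\<gamma> t \<bullet> ?\<gamma> t) has_real_derivative 2 * (x \<bullet> u)) (at 0)"
    by simp
  then have "((\<lambda>t. 1 - c * (?\<gamma> t \<bullet> ?\<gamma> t)) has_real_derivative 0 - c * (2 * (x \<bullet> u))) (at 0)"
    by (intro DERIV_diff DERIV_const DERIV_cmult)
  from DERIV_mult[OF mp_eval_has_derivative_along_curve[OF \<gamma>, of f] this]
  have "((\<lambda>t. mp_eval (g_poly d f) (?\<gamma> t)) has_real_derivative
      (1 - c * (x \<bullet> x)) * (mp_grad f x \<bullet> u) - 2 * c * mp_eval f x * (x \<bullet> u)) (at 0)"
    unfolding mp_eval_g_poly c_def[symmetric] by (simp add: mult_ac)
  then have "mp_grad (g_poly d f) x \<bullet> u =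
      (1 - c * (x \<bullet> x)) * (mp_grad f x \<bullet> u) - 2 * c * mp_eval f x * (x \<bullet> u)"
    using mp_eval_has_derivative_along_curve[OF \<gamma>, of "g_poly d f"] DERIV_unique by fastforce
  then show "mp_grad (g_poly d f) x \<bullet> u = ((1 - real d / (real d + 2) * (x \<bullet> x)) *\<^sub>R mp_grad f x
    - (2 * (real d / (real d + 2)) * mp_eval f x) *\<^sub>R x) \<bullet> u"
    by (simp only: inner_diff_left inner_scaleR_left c_def)
qed

lemma mp_eval_g_poly_sphere:
  assumes "norm x = 1"
  shows "mp_eval (g_poly d f) x = 2 / (real d + 2) * mp_eval f x"
  using assms by (simp add: mp_eval_g_poly dot_square_norm field_simps)

text \<open>
  This is what the factor \<open>d/(d+2)\<close> is made for: on the sphere \<open>\<nabla>g = 2/(d+2) (\<nabla>f - d f x)\<close>, so the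
  Lagrange equation of \<open>f\<close> on the sphere becomes the unconstrained equation \<open>\<nabla>g = 0\<close>.
\<close>

lemma grad_g_poly_zero:
  assumes "is_form d f" "sphere_local_minimizer (mp_eval f) x"
  shows "mp_grad (g_poly d f) x = 0"
proof -
  have "x \<bullet> x = 1" using assms(2) by (simp add: sphere_local_minimizer_def norm_eq_1)
  then have "mp_grad (g_poly d f) x = ((1 - real d / (real d + 2)) * (real d * mp_eval f x)
      - 2 * (real d / (real d + 2)) * mp_eval f x) *\<^sub>R x"
    by (simp add: mp_grad_g_poly grad_at_local_minimizer[OF assms] scaleR_diff_left)
  also have "(1 - real d / (real d + 2)) = 2 / (real d + 2)"
    by (simp add: field_simps)
  finally show ?thesis by simp
qed

text \<open>
  A real critical point avoids \<open>W 0\<close>, hence lies on some component \<open>W j\<close>, and the value of \<open>g\<close> on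
  that component is one of the enumerated values.
\<close>

lemma real_critical_point_in_regrouped:
  assumes "regrouped_decomposition g s W r W' v" "mp_grad g x = 0"
  obtains i where "i \<in> {1..r}" "complex_vec x \<in> W' i" "mp_eval g x = v i"
proof -
  note decomp = assms(1)[unfolded regrouped_decomposition_def grad_decomposition_def]
  from decomp have V: "V_grad g = (\<Union>j\<in>{0..s}. W j)" by (elim conjE)
  from decomp have W0: "W 0 \<inter> range complex_vec = {}" by (elim conjE)
  from decomp have const: "\<forall>j\<in>{1..s}. irreducible_variety (W j) \<and> (\<exists>c. const_on g c (W j))"
    by (elim conjE)
  from decomp have bij: "bij_betw v {1..r} {c. \<exists>j\<in>{1..s}. const_on g c (W j)}" by (elim conjE)
  from decomp have W': "\<forall>i\<in>{1..r}. W' i = \<Union>{W j | j. j \<in> {1..s} \<and> const_on g (v i) (W j)}"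
    by (elim conjE)
  have "complex_vec x \<in> V_grad g" using assms(2) by (simp add: complex_vec_in_V_grad_iff)
  then obtain j where j: "j \<in> {0..s}" "complex_vec x \<in> W j" unfolding V by auto
  then have "j \<noteq> 0" using W0 by (metis disjoint_iff rangeI)
  then have js: "j \<in> {1..s}" using j(1) by simp
  then obtain c where c: "const_on g c (W j)" using const by blast
  then have "c \<in> v ` {1..r}" using bij_betw_imp_surj_on[OF bij] js by blast
  then obtain i where i: "i \<in> {1..r}" "v i = c" by blast
  have "complex_vec x \<in> W' i" using bspec[OF W' i(1)] js j(2) c i(2) by blast
  moreover have "mp_eval g x = v i"
    using c j(2) i(2) by (auto simp: const_on_def mp_eval_complexify)
  ultimately show thesis using that i(1) by blast
qed

section \<open>Absence of spurious negative local minima\<close>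

theorem corollary3p4:
  fixes f :: "('n::finite, real) mpol"
    and d s r :: nat
    and W W' :: "nat \<Rightarrow> (complex ^ 'n) set"
    and v :: "nat \<Rightarrow> real"
  assumes "CARD('n) \<ge> 2"
    and "d > 2"
    and "is_form d f"
    and "regrouped_decomposition (g_poly d f) s W r W' v"
    and "\<exists>!j. j \<in> {1..r} \<and> W' j \<inter> complex_vec ` Omega f \<noteq> {}"
  shows "\<not> (\<exists>c. spurious_negative_local_minimum (mp_eval f) c)"
proof
  assume "\<exists>c. spurious_negative_local_minimum (mp_eval f) c"
  then obtain x where x: "sphere_local_minimizer (mp_eval f) x" and neg: "mp_eval f x < 0"
    and spurious: "\<not> sphere_global_minimum (mp_eval f) (mp_eval f x)"
    unfolding spurious_negative_local_minimum_def sphere_local_minimum_def by auto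
  from assms(5) obtain j where
    uniq: "\<And>i. i \<in> {1..r} \<Longrightarrow> W' i \<inter> complex_vec ` Omega f \<noteq> {} \<Longrightarrow> i = j" by blast
  \<comment> \<open>Negative local minimizers all lie on the one component group that meets \<open>Omega f\<close>.\<close>
  have value_eq: "2 / (real d + 2) * mp_eval f y = v j"
    if y: "sphere_local_minimizer (mp_eval f) y" "mp_eval f y < 0" for y
  proof -
    obtain i where i: "i \<in> {1..r}" "complex_vec y \<in> W' i" "mp_eval (g_poly d f) y = v i"
      using real_critical_point_in_regrouped[OF assms(4) grad_g_poly_zero[OF assms(3) y(1)]] .
    have "y \<in> Omega f"
      using negative_local_minimizer_in_Omega[OF assms(3) y(1) assms(1) y(2)] .
    then have "i = j" using uniq[of i] i by blast
    moreover have "norm y = 1" using y(1) by (simp add: sphere_local_minimizer_def)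
    ultimately show ?thesis using i(3) by (simp add: mp_eval_g_poly_sphere)
  qed
  \<comment> \<open>A global minimizer is itself a negative local minimizer, so \<open>f\<close> has the same value there.\<close>
  have sx: "x \<in> sphere 0 1" using x by (simp add: sphere_local_minimizer_def)
  then have "sphere 0 1 \<noteq> ({} :: (real ^ 'n) set)" by blast
  then obtain y where y: "y \<in> sphere 0 1" "\<forall>z\<in>sphere 0 1. mp_eval f y \<le> mp_eval f z"
    using continuous_attains_inf[OF compact_sphere _ continuous_on_mp_eval] by blast
  then have "sphere_local_minimizer (mp_eval f) y"
    by (auto simp: sphere_local_minimizer_def intro!: exI[of _ 1])
  moreover have "mp_eval f y < 0" using y(2) sx neg by fastforce
  ultimately have "2 / (real d + 2) * mp_eval f x = 2 / (real d + 2) * mp_eval f y"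
    using value_eq x neg by simp
  moreover have "real d + 2 \<noteq> 0" by linarith
  ultimately have "mp_eval f x = mp_eval f y" by simp
  then show False using spurious y by (auto simp: sphere_global_minimum_def)
qed

end
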